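(* Let $p$ and $q$ be monic real-rooted polynomials of degree $n$, each with simple roots, having a common interlacer and having distinct roots (no root of $p$ is a root of $q$). Let $\lambda_1>\dots>\lambda_n$ be the roots of $p$ and $\mu_1>\dots>\mu_n$ the roots of $q$. Assume $p\succeq q$ (that is, $p$ majorizes $q$). If $\sum_{i=1}^k\lambda_i=\sum_{i=1}^k\mu_i$ for some integer $k$ with $1<k<n$, then there exists $k_0\le k$ (with $k_0\geq 1$) such that $$\sum_{i=1}^{k_0}\frac{q(\lambda_i)}{p'(\lambda_i)}<0 .$$ So, in this case, $p$ does not strongly majorize $q$.
   Context: Roots are always listed in nonincreasing order (with multiplicity). Majorization: for real vectors $a_1\ge\dots\ge a_n$ and $b_1\ge\dots\ge b_n$, $a\succeq b$ means $\sum_{i=1}^k a_i\ge\sum_{i=1}^k b_i$ for all $k\le n$ and $\sum_{i=1}^n a_i=\sum_{i=1}^n b_i$. For real-rooted polynomials of the same degree, one majorizes the other ($\succeq$) if its ordered root vector majorizes that of the other. Common interlacer: $p$ and $q$ have a common interlacer if there is a third polynomial interlacing both; explicitly, the closed intervals with endpoints $\lambda_i,\mu_i$ ($1\le i\le n$) are non-crossing, i.e. $\max(\lambda_{i+1},\mu_{i+1})\le\min(\lambda_i,\mu_i)$ for $1\le i<n$. In that case $tp+(1-t)q$ is real-rooted for every $t\in[0,1]$. Strong majorization: for $p,q$ with a common interlacer, let $\lambda_1(t)\ge\dots\ge\lambda_n(t)$ be the roots of $tp+(1-t)q$ and $S_k(t)=\sum_{i=1}^k\lambda_i(t)$, $t\in[0,1]$.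 Then $p$ strongly majorizes $q$ ($p\succeq^s q$) means that $sp+(1-s)q\succeq tp+(1-t)q$ for all $0\le t\le s\le 1$; that is, each $S_k$ is nondecreasing on $[0,1]$ and $S_n$ is constant. *)

theory Defs
  imports "HOL-Computational_Algebra.Computational_Algebra"
begin

definition real_rooted :: "real poly \<Rightarrow> bool" where
  "real_rooted p \<longleftrightarrow>
     p \<noteq> 0 \<and> (\<forall>z::complex. poly (map_poly complex_of_real p) z = 0 \<longrightarrow> z \<in> \<real>)"

(* The real roots with multiplicity, in nonincreasing order.  List positions start at 0, so
   the i-th largest root is "ordered_roots p ! (i - 1)", and a sum over the k largest roots
   is a sum over i < k. *)
definition ordered_roots :: "real poly \<Rightarrow> real list" where
  "ordered_roots p = rev (sorted_list_of_multiset (proots p))"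

(* Both vectors are meant to be nonincreasing. *)
definition vec_majorizes :: "real list \<Rightarrow> real list \<Rightarrow> bool" where
  "vec_majorizes a b \<longleftrightarrow> length a = length b \<and>
     (\<forall>k\<le>length a. (\<Sum>i<k. a ! i) \<ge> (\<Sum>i<k. b ! i)) \<and>
     (\<Sum>i<length a. a ! i) = (\<Sum>i<length b. b ! i)"

(* Meant for real-rooted polynomials of the same degree. *)
definition majorizes :: "real poly \<Rightarrow> real poly \<Rightarrow> bool" (infix "\<succeq>" 50) where
  "p \<succeq> q \<longleftrightarrow> vec_majorizes (ordered_roots p) (ordered_roots q)"

(* r has degree one less than p, and the roots satisfy
   p_1 \<ge> r_1 \<ge> p_2 \<ge> r_2 \<ge> ... \<ge> r_(n-1) \<ge> p_n. *)
definition interlaces :: "real poly \<Rightarrow> real poly \<Rightarrow> bool" where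
  "interlaces r p \<longleftrightarrow> real_rooted r \<and> real_rooted p \<and> degree p = Suc (degree r) \<and>
     (\<forall>i<degree r. ordered_roots p ! Suc i \<le> ordered_roots r ! i \<and>
                   ordered_roots r ! i \<le> ordered_roots p ! i)"

definition common_interlacer :: "real poly \<Rightarrow> real poly \<Rightarrow> bool" where
  "common_interlacer p q \<longleftrightarrow> (\<exists>r. interlaces r p \<and> interlaces r q)"

(* Meant for monic polynomials with a common interlacer: every convex combination is then
   real-rooted, of the same degree as p and q. *)
definition strongly_majorizes :: "real poly \<Rightarrow> real poly \<Rightarrow> bool" (infix "\<succeq>\<^sup>s" 50) where
  "p \<succeq>\<^sup>s q \<longleftrightarrow> (\<forall>s t::real. 0 \<le> t \<and> t \<le> s \<and> s \<le> 1 \<longrightarrow>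
     smult s p + smult (1 - s) q \<succeq> smult t p + smult (1 - t) q)"

lemma map_poly_of_real_mult:
  "map_poly complex_of_real (p * q) = map_poly complex_of_real p * map_poly complex_of_real q"
  by (rule poly_eqI) (simp add: coeff_map_poly coeff_mult)

lemma length_ordered_roots:
  assumes "real_rooted p"
  shows "length (ordered_roots p) = degree p"
proof -
  have "size (proots p) = degree p" if "real_rooted p" for p
    using that
  proof (induction "degree p" arbitrary: p rule: less_induct)
    case less
    show ?case
    proof (cases "degree p = 0")
      case True
      then show ?thesis using size_proots_le[of p] by simp
    next
      case False
      let ?c = "map_poly complex_of_real"
      have p0: "p \<noteq> 0" using less.prems by (simp add: real_rooted_def)
      have "degree (?c p) = degree p" by (simp add: degree_map_poly)
      then have "\<not> constant (poly (?c p))" using False by (simp add: constant_degree)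
      then obtain z where z: "poly (?c p) z = 0" using fundamental_theorem_of_algebra by blast
      then have "z \<in> \<real>" using less.prems by (simp add: real_rooted_def)
      then obtain x where x: "z = complex_of_real x" by (auto elim: Reals_cases)
      have "poly (?c p) (complex_of_real x) = complex_of_real (poly p x)"
        by (induction p) (auto simp: map_poly_pCons)
      then have "poly p x = 0" using z by (simp add: x)
      then obtain r where r: "p = [:-x, 1:] * r" by (metis poly_eq_0_iff_dvd dvdE)
      have r0: "r \<noteq> 0" using p0 r by auto
      have deg: "degree p = Suc (degree r)" unfolding r
        using r0 by (subst degree_mult_eq) auto
      have cp: "?c p = ?c [:-x, 1:] * ?c r" unfolding r
        by (rule map_poly_of_real_mult)
      have "real_rooted r" using less.prems r0 unfolding real_rooted_def cp by auto
      then have "size (proots r) = degree r" using less.hyps[of r] deg by simp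
      moreover have "proots p = {#x#} + proots r" unfolding r
        using r0 by (subst proots_mult) auto
      ultimately show ?thesis using deg by simp
    qed
  qed
  then show ?thesis using assms
    by (metis ordered_roots_def length_rev mset_sorted_list_of_multiset size_mset)
qed

lemma ordered_roots_prod:
  fixes xs :: "real list"
  assumes "sorted (rev xs)"
  defines "r \<equiv> \<Prod>x\<leftarrow>xs. [:-x, 1:]"
  shows "ordered_roots r = xs" "real_rooted r" "degree r = length xs"
proof -
  have r0: "r \<noteq> 0" by (auto simp: r_def prod_list_zero_iff)
  have "proots r = mset xs"
    unfolding r_def
    by (induction xs)
       (simp_all add: proots_mult prod_list_zero_iff image_iff del: mult_pCons_left)
  then show "ordered_roots r = xs" unfolding ordered_roots_def
    by (metis assms(1) mset_rev rev_rev_ident sorted_list_of_multiset_mset sorted_sort_id)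
  show "degree r = length xs" unfolding r_def
    by (induction xs)
       (simp_all add: degree_mult_eq prod_list_zero_iff image_iff del: mult_pCons_left)
  have "poly (map_poly complex_of_real (\<Prod>x\<leftarrow>xs. [:-x, 1:])) z = (\<Prod>x\<leftarrow>xs. z - of_real x)" for z
  proof (induction xs)
    case (Cons a xs)
    have "map_poly complex_of_real ([:-a, 1:] * (\<Prod>x\<leftarrow>xs. [:-x, 1:]))
      = map_poly complex_of_real [:-a, 1:] * map_poly complex_of_real (\<Prod>x\<leftarrow>xs. [:-x, 1:])"
      by (rule map_poly_of_real_mult)
    then show ?case using Cons by (simp add: map_poly_pCons del: mult_pCons_left)
  qed simp
  then show "real_rooted r" using r0 unfolding real_rooted_def r_def
    by (auto simp: prod_list_zero_iff)
qed

lemma common_interlacer_iff: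
  assumes "real_rooted p" "real_rooted q" "degree p = n" "degree q = n" "n > 0"
  shows "common_interlacer p q \<longleftrightarrow>
    (\<forall>i. Suc i < n \<longrightarrow> max (ordered_roots p ! Suc i) (ordered_roots q ! Suc i) \<le>
                     min (ordered_roots p ! i) (ordered_roots q ! i))" (is "?L \<longleftrightarrow> ?R")
proof
  assume ?L
  then show ?R using assms by (fastforce simp: common_interlacer_def interlaces_def)
next
  assume R: ?R
  define f where "f i = min (ordered_roots p ! i) (ordered_roots q ! i)" for i
  define xs where "xs = map f [0..<n - 1]"
  have len: "length (ordered_roots p) = n" using length_ordered_roots assms by simp
  have len': "length (ordered_roots q) = n" using length_ordered_roots assms by simp
  have "f j \<le> f i" if "i \<le> j" "j < n" for i j
  proof -
    have *: "xs ! j \<le> xs ! i" if "sorted (rev xs)" "i \<le> j" "j < length xs" for xs :: "real list"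
      using that \<open>i \<le> j\<close> sorted_rev_nth_mono by blast
    have "sorted (rev (ordered_roots p))" "sorted (rev (ordered_roots q))"
      by (simp_all add: ordered_roots_def)
    from *[OF this(1)] *[OF this(2)] show ?thesis
      using that len len' unfolding f_def by (intro min.mono) auto
  qed
  then have "sorted (rev xs)"
    by (auto simp: xs_def sorted_rev_iff_nth_mono)
  from ordered_roots_prod[OF this] obtain r where
    r: "ordered_roots r = xs" "real_rooted r" "degree r = n - 1" by (auto simp: xs_def)
  show ?L unfolding common_interlacer_def interlaces_def
    using r assms R by (intro exI[of _ r]) (auto simp: xs_def f_def)
qed

end

theory Submission
  imports Defs
begin

text \<open>
  Write \<open>a\<^sub>i\<close> and \<open>b\<^sub>i\<close> for the roots of \<open>p\<close> and \<open>q\<close> in decreasing order, counted from \<open>0\<close>. In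
  factored form the summand is
  \<open>q(a\<^sub>i) / p'(a\<^sub>i) = \<Prod>\<^sub>j (a\<^sub>i - b\<^sub>j) / \<Prod>\<^sub>j\<^sub>\<noteq>\<^sub>i (a\<^sub>i - a\<^sub>j)\<close>. For \<open>i < k\<close> it splits as \<open>c\<^sub>i e\<^sub>i\<close>, where
  \<open>e\<^sub>i\<close> collects the factors with \<open>j < k\<close> and
  \<open>c\<^sub>i = \<Prod>\<^sub>j\<^sub>\<ge>\<^sub>k (a\<^sub>i - b\<^sub>j) / (a\<^sub>i - a\<^sub>j)\<close> those with \<open>j \<ge> k\<close>.

  The head factors are the Lagrange weights of the two degree-\<open>k\<close> polynomials built from the top
  \<open>k\<close> roots, so their sum is the difference of the sums of these roots
  (\<open>lagrange_sum_root_differences\<close>), which is \<open>0\<close> by assumption; no \<open>e\<^sub>i\<close> vanishes because \<open>p\<close> and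
  \<open>q\<close> share no root. The tail factors are positive by the common interlacer. Since the sums of the
  top \<open>k\<close> roots agree, the remaining roots of \<open>p\<close> still majorize those of \<open>q\<close>. For \<open>x < y\<close> the
  function \<open>t \<mapsto> ln (y - t) - ln (x - t)\<close> is strictly convex on \<open>t < x\<close>, so Karamata's
  inequality shows that \<open>c\<close> is strictly decreasing in the point at which it is evaluated
  (\<open>prod_ratio_strict_antimono\<close>), that is, \<open>c\<^sub>0 < c\<^sub>1 < \<dots>\<close>. If all partial sums of \<open>c\<^sub>i e\<^sub>i\<close> were
  nonnegative, summation by parts against the strictly decreasing weights \<open>1 / c\<^sub>i\<close> would make
  \<open>\<Sum> e\<^sub>i\<close> nonnegative, with equality only if \<open>e\<^sub>0 = 0\<close>: a contradiction
  (\<open>weighted_partial_sum_neg\<close>).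

  The number \<open>q(a\<^sub>i) / p'(a\<^sub>i)\<close> is the derivative at \<open>t = 1\<close> of the \<open>i\<close>-th root of
  \<open>t p + (1 - t) q\<close>. A negative partial sum therefore means that the corresponding sum of largest
  roots exceeds its value at \<open>t = 1\<close> for \<open>t\<close> slightly below \<open>1\<close>, which strong majorization
  forbids (\<open>not_strongly_majorizes_if_partial_sum_neg\<close>). Locating the roots to first order needs
  only sign changes on intervals of length proportional to \<open>1 - t\<close>: these supply as many distinct
  roots as the degree admits.
\<close>

section \<open>Summation by parts and partial sums\<close>

lemma sum_mult_by_parts:
  fixes f d :: "nat \<Rightarrow> 'a::comm_ring"
  shows "(\<Sum>i<Suc m. f i * d i) =
    (\<Sum>i<m. (f i - f (Suc i)) * (\<Sum>j<Suc i. d j)) + f m * (\<Sum>j<Suc m. d j)"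
  by (induction m) (simp_all add: algebra_simps)

lemma sum_nonneg_if_partial_sums_nonneg:
  fixes f d :: "nat \<Rightarrow> real"
  assumes "\<And>i. Suc i < n \<Longrightarrow> f (Suc i) \<le> f i"
    and "\<And>m. m \<le> n \<Longrightarrow> 0 \<le> (\<Sum>i<m. d i)" and "(\<Sum>i<n. d i) = 0"
  shows "0 \<le> (\<Sum>i<n. f i * d i)"
proof (cases n)
  case (Suc m)
  have "0 \<le> (\<Sum>i<m. (f i - f (Suc i)) * (\<Sum>j<Suc i. d j))"
  proof (rule sum_nonneg)
    fix i assume "i \<in> {..<m}"
    then show "0 \<le> (f i - f (Suc i)) * (\<Sum>j<Suc i. d j)"
      using assms(1)[of i] assms(2)[of "Suc i"] Suc by (intro mult_nonneg_nonneg) auto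
  qed
  then show ?thesis
    using assms(3) unfolding Suc sum_mult_by_parts by (simp del: sum.lessThan_Suc)
qed simp

section \<open>Karamata's inequality for products of ratios\<close>

text \<open>
  This is the tangent line inequality at \<open>b\<close> for the strictly convex function
  \<open>t \<mapsto> ln (y - t) - ln (x - t)\<close>. Instead of differentiating, the logarithms are compared
  with \<open>ln z \<le> z - 1\<close> at the cross ratio of \<open>a, b\<close> and \<open>x, y\<close>; the slack is then an explicit positive
  fraction.
\<close>

lemma ln_ratio_tangent:
  fixes x y a b :: real
  assumes "x < y" "a < x" "b < x" "a \<noteq> b"
  shows "(ln (y - a) - ln (x - a)) - (ln (y - b) - ln (x - b))
           > (1 / (x - b) - 1 / (y - b)) * (a - b)"
proof -
  define z where "z = (x - a) * (y - b) / ((x - b) * (y - a))"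
  have pos: "x - a > 0" "x - b > 0" "y - a > 0" "y - b > 0" using assms by auto
  have "ln z \<le> z - 1" using pos by (intro ln_le_minus_one) (simp add: z_def)
  moreover have "ln z = ln (x - a) + ln (y - b) - (ln (x - b) + ln (y - a))"
    using pos by (simp add: z_def ln_div ln_mult)
  moreover have "1 - z - (1 / (x - b) - 1 / (y - b)) * (a - b)
      = (y - x) * (a - b)\<^sup>2 / ((x - b) * (y - b) * (y - a))"
    using pos by (simp add: z_def divide_simps) algebra
  moreover have "(y - x) * (a - b)\<^sup>2 / ((x - b) * (y - b) * (y - a)) > 0"
    using pos assms by simp
  ultimately show ?thesis by linarith
qed

text \<open>
  Karamata's inequality: summing the tangent inequalities at the points \<open>b i\<close> leaves the sum of
  slope times \<open>a i - b i\<close>, which is nonnegative because the slopes decrease along the list while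
  the partial sums of \<open>a i - b i\<close> are nonnegative with total zero.
\<close>

lemma prod_ratio_strict_antimono:
  fixes a b :: "nat \<Rightarrow> real"
  assumes "0 < n" "\<And>i. i < n \<Longrightarrow> a i < x" "\<And>i. i < n \<Longrightarrow> b i < x" "x < y"
    and "\<And>i. i < n \<Longrightarrow> a i \<noteq> b i"
    and "\<And>i. Suc i < n \<Longrightarrow> b (Suc i) \<le> b i"
    and "\<And>m. m \<le> n \<Longrightarrow> (\<Sum>i<m. b i) \<le> (\<Sum>i<m. a i)"
    and "(\<Sum>i<n. a i) = (\<Sum>i<n. b i)"
  shows "(\<Prod>i<n. (y - b i) / (y - a i)) < (\<Prod>i<n. (x - b i) / (x - a i))"
proof -
  let ?s = "\<lambda>i. 1 / (x - b i) - 1 / (y - b i)"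
  have s_eq: "?s i = (y - x) / ((x - b i) * (y - b i))" if "i < n" for i
    using assms(3)[OF that] assms(4) by (simp add: field_simps)
  have mono: "?s (Suc i) \<le> ?s i" if "Suc i < n" for i
  proof -
    have "b (Suc i) \<le> b i" "b i < x" using assms(3,6) that by auto
    then have "(x - b i) * (y - b i) \<le> (x - b (Suc i)) * (y - b (Suc i))"
      "(x - b i) * (y - b i) > 0"
      using assms(4) by (auto intro!: mult_mono)
    then have "(y - x) / ((x - b (Suc i)) * (y - b (Suc i))) \<le> (y - x) / ((x - b i) * (y - b i))"
      using assms(4) by (intro divide_left_mono) (auto simp: less_le_trans)
    then show ?thesis using s_eq that by simp
  qed
  have "0 \<le> (\<Sum>i<n. ?s i * (a i - b i))"
    using assms mono by (intro sum_nonneg_if_partial_sums_nonneg) (auto simp: sum_subtractf)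
  also have "\<dots> < (\<Sum>i<n. (ln (y - a i) - ln (x - a i)) - (ln (y - b i) - ln (x - b i)))"
    using assms by (intro sum_strict_mono ln_ratio_tangent) auto
  also have "\<dots> = (\<Sum>i<n. ln ((x - b i) / (x - a i))) - (\<Sum>i<n. ln ((y - b i) / (y - a i)))"
    unfolding sum_subtractf[symmetric]
    using assms(2,3,4) by (intro sum.cong refl) (fastforce simp: ln_div)
  finally have lt: "(\<Sum>i<n. ln ((y - b i) / (y - a i))) < (\<Sum>i<n. ln ((x - b i) / (x - a i)))"
    by simp
  have pos: "(z - b i) / (z - a i) > 0" if "z \<ge> x" "i < n" for z i
    using assms(2,3)[of i] that by simp
  have ln_eq: "ln (\<Prod>i<n. (z - b i) / (z - a i)) = (\<Sum>i<n. ln ((z - b i) / (z - a i)))"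
    if "z \<ge> x" for z
    by (rule ln_prod) (use pos[OF that] in fastforce)+
  have "ln (\<Prod>i<n. (y - b i) / (y - a i)) < ln (\<Prod>i<n. (x - b i) / (x - a i))"
    using lt assms(4) by (simp only: ln_eq order_refl less_imp_le)
  then show ?thesis using pos assms(4)
    by (subst (asm) ln_less_cancel_iff) (auto intro!: prod_pos)
qed

section \<open>A sign principle for weighted sums\<close>

text \<open>
  Nonnegative partial sums of \<open>c i * e i\<close> would survive multiplication by the strictly
  decreasing weights \<open>1 / c i\<close>, which turns them into \<open>e i\<close>. As the \<open>e i\<close> add up to zero, every
  term in the summation by parts then vanishes; the first of them contains \<open>c 0 * e 0\<close> alone.
\<close>

lemma weighted_partial_sum_neg:
  fixes c e :: "nat \<Rightarrow> real"
  assumes "\<And>i. i < k \<Longrightarrow> 0 < c i" "\<And>i. Suc i < k \<Longrightarrow> c i < c (Suc i)"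
    and "(\<Sum>i<k. e i) = 0" "0 < k" "e 0 \<noteq> 0"
  shows "\<exists>m. 1 \<le> m \<and> m \<le> k \<and> (\<Sum>i<m. c i * e i) < 0"
proof (rule ccontr)
  assume neg: "\<not> ?thesis"
  then have T: "0 \<le> (\<Sum>i<m. c i * e i)" if "m \<le> k" for m
    using that by (cases "m = 0") (auto simp: not_less)
  obtain l where l: "k = Suc l" using assms(4) by (cases k) auto
  have dec: "1 / c (Suc i) < 1 / c i" if "i < l" for i
    using assms(1,2)[of i] that l by (simp add: frac_less2)
  have "(\<Sum>i<k. e i) = (\<Sum>i<Suc l. 1 / c i * (c i * e i))"
    unfolding l using assms(1) l by (intro sum.cong) (force simp: less_imp_neq[symmetric])+
  also have "\<dots> = (\<Sum>i<l. (1 / c i - 1 / c (Suc i)) * (\<Sum>j<Suc i. c j * e j))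
      + 1 / c l * (\<Sum>j<Suc l. c j * e j)"
    by (rule sum_mult_by_parts)
  finally have tot: "0 = \<dots>" using assms(3) by simp
  have terms: "0 \<le> (1 / c i - 1 / c (Suc i)) * (\<Sum>j<Suc i. c j * e j)" if "i < l" for i
    using dec[OF that] T[of "Suc i"] that l by (intro mult_nonneg_nonneg) auto
  have last: "0 \<le> 1 / c l * (\<Sum>j<Suc l. c j * e j)"
    using T[of k] assms(1)[of l] l by (intro mult_nonneg_nonneg) (auto simp: less_imp_le)
  have nonneg: "0 \<le> (\<Sum>i<l. (1 / c i - 1 / c (Suc i)) * (\<Sum>j<Suc i. c j * e j))"
    using terms by (intro sum_nonneg) simp
  have S0: "(\<Sum>i<l. (1 / c i - 1 / c (Suc i)) * (\<Sum>j<Suc i. c j * e j)) = 0"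
    and L0: "1 / c l * (\<Sum>j<Suc l. c j * e j) = 0"
    using tot last nonneg by linarith+
  have "(\<Sum>j<Suc 0. c j * e j) = 0"
  proof (cases "l = 0")
    case True
    then show ?thesis using L0 assms(1)[of l] l by simp
  next
    case False
    then have "(1 / c 0 - 1 / c (Suc 0)) * (\<Sum>j<Suc 0. c j * e j) = 0"
      using S0 terms by (subst (asm) sum_nonneg_eq_0_iff) auto
    then show ?thesis using dec[of 0] False
      by (metis diff_gt_0_iff_gt gr0I less_irrefl mult_eq_0_iff)
  qed
  then show False using assms(1)[of 0] assms(4,5) by simp
qed

section \<open>Products of linear factors and Lagrange weights\<close>

lemma degree_prod_linear: "degree (\<Prod>i\<in>A. [:- a i, 1:]) = card A"
  for a :: "'i \<Rightarrow> 'a::idom"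
  by (subst degree_prod_sum_eq) auto

lemma lead_coeff_prod_linear: "lead_coeff (\<Prod>i\<in>A. [:- a i, 1:]) = 1"
  for a :: "'i \<Rightarrow> 'a::idom"
  by (simp add: lead_coeff_prod)

lemma poly_prod_linear: "poly (\<Prod>i\<in>A. [:- a i, 1:]) x = (\<Prod>i\<in>A. x - a i)"
  for a :: "'i \<Rightarrow> 'a::idom"
  by (simp add: poly_prod)

lemma coeff_prod_linear_subleading:
  fixes a :: "'i \<Rightarrow> 'a::idom"
  assumes "finite A" "card A = Suc m"
  shows "coeff (\<Prod>i\<in>A. [:- a i, 1:]) m = - (\<Sum>i\<in>A. a i)"
  using assms
proof (induction A arbitrary: m rule: finite_induct)
  case (insert x A)
  let ?P = "\<Prod>i\<in>A. [:- a i, 1:]"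
  have cA: "card A = m" using insert by simp
  have lc: "coeff ?P m = 1" using lead_coeff_prod_linear[of a A] by (simp add: degree_prod_linear cA)
  have "coeff ([:- a x, 1:] * ?P) m = - a x + coeff (pCons 0 ?P) m"
    by (simp add: lc)
  also have "coeff (pCons 0 ?P) m = - (\<Sum>i\<in>A. a i)"
  proof (cases m)
    case 0
    then show ?thesis using cA insert.hyps by simp
  next
    case (Suc l)
    then show ?thesis using insert.IH[of l] cA by simp
  qed
  finally show ?case using insert.hyps by simp
qed simp

text \<open>
  The left side is the leading coefficient of the Lagrange interpolation polynomial at the nodes
  \<open>a i\<close>, and a polynomial of degree below the number of nodes equals its own interpolant.
\<close>

lemma lagrange_leading_coeff:
  fixes F :: "'a::field poly" and a :: "'i \<Rightarrow> 'a"
  assumes fin: "finite A" and inj: "inj_on a A" and deg: "degree F \<le> m" and card: "card A = Suc m"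
  shows "(\<Sum>i\<in>A. poly F (a i) / (\<Prod>j\<in>A-{i}. a i - a j)) = coeff F m"
proof -
  define w where "w i = poly F (a i) / (\<Prod>j\<in>A-{i}. a i - a j)" for i
  define L where "L = (\<Sum>i\<in>A. smult (w i) (\<Prod>j\<in>A-{i}. [:- a j, 1:]))"
  have cA: "card (A - {i}) = m" if "i \<in> A" for i using that card fin by simp
  have degL: "degree L \<le> m" unfolding L_def
    by (rule degree_sum_le[OF fin], rule order_trans[OF degree_smult_le])
       (simp add: degree_prod_linear cA card)
  have lc: "coeff (\<Prod>j\<in>A-{i}. [:- a j, 1:]) m = 1" if "i \<in> A" for i
    using lead_coeff_prod_linear[of a "A - {i}"] by (simp add: degree_prod_linear cA[OF that])
  have "poly L (a i) = poly F (a i)" if i: "i \<in> A" for i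
  proof -
    have "poly L (a i) = (\<Sum>l\<in>A. w l * (\<Prod>j\<in>A-{l}. a i - a j))"
      by (simp add: L_def poly_sum poly_prod_linear)
    also have "\<dots> = (\<Sum>l\<in>{i}. w l * (\<Prod>j\<in>A-{l}. a i - a j))"
      using i fin by (intro sum.mono_neutral_right) auto
    also have "\<dots> = poly F (a i)"
      using i fin inj by (auto simp: w_def inj_on_def)
    finally show ?thesis .
  qed
  moreover have "card (a ` A) = Suc m" using card inj by (simp add: card_image)
  ultimately have "L = F"
    using degL deg by (intro poly_eqI_degree[of "a ` A"]) auto
  then have "coeff F m = (\<Sum>i\<in>A. w i * coeff (\<Prod>j\<in>A-{i}. [:- a j, 1:]) m)"
    by (auto simp: L_def coeff_sum)
  then show ?thesis by (simp add: lc w_def)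
qed

text \<open>
  Subtracting the polynomial that vanishes at all nodes changes no value at a node but cancels the
  leading term; what remains in the next coefficient is the difference of the root sums.
\<close>

lemma lagrange_sum_root_differences:
  fixes a b :: "'i \<Rightarrow> 'a::field"
  assumes fin: "finite A" and inj: "inj_on a A"
  shows "(\<Sum>i\<in>A. (\<Prod>j\<in>A. a i - b j) / (\<Prod>j\<in>A-{i}. a i - a j)) = (\<Sum>i\<in>A. a i) - (\<Sum>i\<in>A. b i)"
proof (cases "card A")
  case 0
  then show ?thesis using fin by simp
next
  case (Suc m)
  define F where "F = (\<Prod>j\<in>A. [:- b j, 1:]) - (\<Prod>j\<in>A. [:- a j, 1:])"
  have lc: "coeff (\<Prod>j\<in>A. [:- c j, 1:]) (Suc m) = 1" for c :: "'i \<Rightarrow> 'a"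
    using lead_coeff_prod_linear[of c A] by (simp add: degree_prod_linear Suc)
  have "degree F \<le> Suc m" unfolding F_def
    by (rule degree_diff_le) (simp_all add: degree_prod_linear Suc)
  moreover have "coeff F (Suc m) = 0" by (simp add: F_def lc)
  ultimately have "degree F \<le> m"
    by (metis degree_0 le_Suc_eq leading_coeff_0_iff zero_le)
  from lagrange_leading_coeff[OF fin inj this Suc]
  have "(\<Sum>i\<in>A. poly F (a i) / (\<Prod>j\<in>A-{i}. a i - a j)) = (\<Sum>i\<in>A. a i) - (\<Sum>i\<in>A. b i)"
    by (simp add: F_def coeff_prod_linear_subleading[OF fin Suc])
  moreover have "poly F (a i) = (\<Prod>j\<in>A. a i - b j)" if "i \<in> A" for i
    using that fin by (auto simp: F_def poly_prod_linear)
  ultimately show ?thesis by simp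
qed

lemma monic_eq_prod_roots:
  fixes p :: "'a::idom poly"
  assumes "lead_coeff p = 1" "degree p = n"
    and "\<And>i. i < n \<Longrightarrow> poly p (a i) = 0" and inj: "inj_on a {..<n}"
  shows "p = (\<Prod>i<n. [:- a i, 1:])"
proof (rule poly_eqI_degree_lead_coeff)
  show "coeff p n = coeff (\<Prod>i<n. [:- a i, 1:]) n"
    using assms(1,2) lead_coeff_prod_linear[of a "{..<n}"] by (simp add: degree_prod_linear)
  show "n \<le> card (a ` {..<n})" by (simp add: card_image inj)
qed (use assms(2,3) in \<open>auto simp: degree_prod_linear poly_prod_linear\<close>)

lemma poly_pderiv_prod_linear:
  fixes a :: "'i \<Rightarrow> 'a::idom"
  assumes "finite A" "i \<in> A"
  shows "poly (pderiv (\<Prod>j\<in>A. [:- a j, 1:])) (a i) = (\<Prod>j\<in>A-{i}. a i - a j)"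
proof -
  have "poly (pderiv (\<Prod>j\<in>A. [:- a j, 1:])) (a i) = (\<Sum>l\<in>A. \<Prod>j\<in>A-{l}. a i - a j)"
    by (simp add: pderiv_prod poly_sum poly_prod pderiv_pCons)
  also have "\<dots> = (\<Sum>l\<in>{i}. \<Prod>j\<in>A-{l}. a i - a j)"
    using assms by (intro sum.mono_neutral_right) auto
  finally show ?thesis by simp
qed

section \<open>A negative partial sum of the residues\<close>

lemma strict_antimono_if_Suc:
  fixes a :: "nat \<Rightarrow> 'a::order"
  assumes "\<And>i. Suc i < n \<Longrightarrow> a (Suc i) < a i" and "i < j" "j < n"
  shows "a j < a i"
  using assms(2,3)
proof (induction j)
  case (Suc j)
  then show ?case using assms(1)[of j] by (cases "i = j") auto
qed simp

lemma inj_on_if_Suc_less: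
  fixes a :: "nat \<Rightarrow> 'a::linorder"
  assumes "\<And>i. Suc i < n \<Longrightarrow> a (Suc i) < a i"
  shows "inj_on a {..<n}"
  by (rule inj_onI, rule ccontr)
     (use strict_antimono_if_Suc[of n a, OF assms] in \<open>fastforce simp: neq_iff\<close>)

text \<open>
  The head factors \<open>e\<close> and the tail factors \<open>c\<close> of the weights satisfy the hypotheses of
  \<open>weighted_partial_sum_neg\<close>: \<open>c\<close> increases because the points \<open>a i\<close> decrease, and the tails still
  majorize because the heads have equal sums.
\<close>

lemma lagrange_partial_sum_neg:
  fixes a b :: "nat \<Rightarrow> real"
  assumes a: "\<And>i. Suc i < n \<Longrightarrow> a (Suc i) < a i"
    and b: "\<And>i. Suc i < n \<Longrightarrow> b (Suc i) < b i"
    and ba: "\<And>i. Suc i < n \<Longrightarrow> b (Suc i) \<le> a i"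
    and ne: "\<And>i j. i < n \<Longrightarrow> j < n \<Longrightarrow> a i \<noteq> b j"
    and maj: "\<And>m. m \<le> n \<Longrightarrow> (\<Sum>i<m. b i) \<le> (\<Sum>i<m. a i)"
    and total: "(\<Sum>i<n. a i) = (\<Sum>i<n. b i)"
    and k: "0 < k" "k < n" and eq: "(\<Sum>i<k. a i) = (\<Sum>i<k. b i)"
  shows "\<exists>m. 1 \<le> m \<and> m \<le> k \<and>
    (\<Sum>i<m. (\<Prod>j<n. a i - b j) / (\<Prod>j\<in>{..<n}-{i}. a i - a j)) < 0"
proof -
  note a_less = strict_antimono_if_Suc[of n a, OF a]
  note b_less = strict_antimono_if_Suc[of n b, OF b]
  have b_less_a: "b j < a i" if "i < j" "j < n" for i j
    using ba[of i] ne[of i j] b_less[of "Suc i" j] that by (cases "j = Suc i") fastforce+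
  define c where "c i = (\<Prod>j<n-k. (a i - b (k + j)) / (a i - a (k + j)))" for i
  define e where "e i = (\<Prod>j<k. a i - b j) / (\<Prod>j\<in>{..<k}-{i}. a i - a j)" for i
  have tail: "(\<Sum>j<m. f (k + j)) = (\<Sum>i<k+m. f i) - (\<Sum>i<k. f i)" for f :: "nat \<Rightarrow> real" and m
    by (induction m) auto
  have "0 < c i" if "i < k" for i
    unfolding c_def by (intro prod_pos) (use b_less_a a_less that k in auto)
  moreover have "c i < c (Suc i)" if "Suc i < k" for i
    unfolding c_def
    by (rule prod_ratio_strict_antimono)
       (use that k a b a_less b_less_a ne maj total eq in \<open>auto simp: tail less_imp_le\<close>)
  moreover have "(\<Sum>i<k. e i) = 0"
    unfolding e_def using eq k
    by (subst lagrange_sum_root_differences)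
       (auto intro: inj_on_subset[OF inj_on_if_Suc_less[of n a, OF a]])
  moreover have "e 0 \<noteq> 0"
    using ne[of 0] a_less[of 0] k by (fastforce simp: e_def)
  ultimately obtain m where m: "1 \<le> m" "m \<le> k" "(\<Sum>i<m. c i * e i) < 0"
    using weighted_partial_sum_neg[of k c e] k by blast
  have "c i * e i = (\<Prod>j<n. a i - b j) / (\<Prod>j\<in>{..<n}-{i}. a i - a j)" if i: "i < k" for i
  proof -
    have split: "(\<Prod>j<n-k. f (k + j)) = (\<Prod>j\<in>{k..<n}. f j)" for f :: "nat \<Rightarrow> real"
      by (rule prod.reindex_bij_witness[of _ "\<lambda>j. j - k" "\<lambda>j. k + j"]) (use k in auto)
    have "(\<Prod>j<n. a i - b j) = (\<Prod>j<k. a i - b j) * (\<Prod>j\<in>{k..<n}. a i - b j)"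
      using k by (subst prod.union_disjoint[symmetric]) (auto intro: prod.cong)
    moreover have "(\<Prod>j\<in>{..<n}-{i}. a i - a j)
        = (\<Prod>j\<in>{..<k}-{i}. a i - a j) * (\<Prod>j\<in>{k..<n}. a i - a j)"
      using k i by (subst prod.union_disjoint[symmetric]) (auto intro!: prod.cong)
    ultimately show ?thesis
      by (simp add: c_def e_def prod_dividef split[of "\<lambda>j. a i - a j"] split[of "\<lambda>j. a i - b j"] mult.commute)
  qed
  then have "(\<Sum>i<m. c i * e i)
      = (\<Sum>i<m. (\<Prod>j<n. a i - b j) / (\<Prod>j\<in>{..<n}-{i}. a i - a j))"
    using m by (intro sum.cong) auto
  then show ?thesis using m by auto
qed

section \<open>Ordered roots of polynomials with simple real roots\<close>

lemma ordered_roots_eqI: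
  assumes "lead_coeff p = 1" "degree p = n"
    and root: "\<And>i. i < n \<Longrightarrow> poly p (a i) = 0"
    and dec: "\<And>i. Suc i < n \<Longrightarrow> a (Suc i) < a i"
  shows "ordered_roots p = map a [0..<n]"
proof -
  have "p = (\<Prod>i<n. [:- a i, 1:])"
    by (rule monic_eq_prod_roots) (use assms inj_on_if_Suc_less[of n a] in auto)
  also have "\<dots> = (\<Prod>x\<leftarrow>map a [0..<n]. [:- x, 1:])"
    by (simp add: prod.list_conv_set_nth atLeast0LessThan)
  also have "ordered_roots \<dots> = map a [0..<n]"
    by (rule ordered_roots_prod(1))
       (auto simp: sorted_rev_iff_nth_mono le_less intro: strict_antimono_if_Suc[of n a, OF dec])
  finally show ?thesis .
qed

lemma ordered_roots_simple:
  assumes "real_rooted p" "rsquarefree p" "degree p = n"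
  shows "i < n \<Longrightarrow> poly p (ordered_roots p ! i) = 0"
    and "Suc i < n \<Longrightarrow> ordered_roots p ! Suc i < ordered_roots p ! i"
proof -
  have p0: "p \<noteq> 0" using assms by (simp add: rsquarefree_def)
  have len: "length (ordered_roots p) = n" using length_ordered_roots assms by simp
  have mset: "mset (ordered_roots p) = proots p"
    by (simp add: ordered_roots_def)
  have set: "set (ordered_roots p) = {x. poly p x = 0}"
    using arg_cong[OF mset, of set_mset] p0 by simp
  then show "i < n \<Longrightarrow> poly p (ordered_roots p ! i) = 0"
    using len nth_mem by fastforce
  have "count (mset (ordered_roots p)) x = (if x \<in> set (ordered_roots p) then 1 else 0)" for x
  proof -
    have "order x p = 0 \<or> order x p = 1" using assms(2) by (simp add: rsquarefree_def)
    then show ?thesis using p0 order_root[of p x] by (auto simp: mset set)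
  qed
  then have "distinct (ordered_roots p)" using distinct_count_atmost_1 by blast
  moreover have "sorted (rev (ordered_roots p))" by (simp add: ordered_roots_def)
  ultimately show "Suc i < n \<Longrightarrow> ordered_roots p ! Suc i < ordered_roots p ! i"
    using len by (fastforce simp: sorted_rev_iff_nth_Suc nth_eq_iff_index_eq less_le)
qed

section \<open>First-order perturbation of the roots\<close>

text \<open>
  At \<open>x - \<epsilon> c\<close> the perturbed polynomial is \<open>\<epsilon> p'(x) (r - c)\<close> to first order in \<open>\<epsilon>\<close>, so its signs
  at \<open>c = r + \<delta>\<close> and \<open>c = r - \<delta>\<close> differ and the intermediate value theorem applies.
\<close>

lemma perturbed_root_eventually:
  fixes p q :: "real poly"
  assumes "poly p x = 0" "poly (pderiv p) x \<noteq> 0" "0 < \<delta>"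
  defines "r \<equiv> poly q x / poly (pderiv p) x"
  shows "\<forall>\<^sub>F \<epsilon> in at_right 0. \<exists>y. \<bar>y - (x - \<epsilon> * r)\<bar> < \<epsilon> * \<delta> \<and>
           poly (smult (1 - \<epsilon>) p + smult \<epsilon> q) y = 0"
proof -
  define D where "D = poly (pderiv p) x"
  define G where "G c \<epsilon> = poly (smult (1 - \<epsilon>) p + smult \<epsilon> q) (x - \<epsilon> * c)" for c \<epsilon>
  have lim: "((\<lambda>\<epsilon>. G c \<epsilon> / \<epsilon>) \<longlongrightarrow> D * (r - c)) (at_right 0)" for c
  proof -
    have "(G c has_real_derivative D * (r - c)) (at 0)"
      unfolding G_def using assms(1,2)
      by (auto intro!: derivative_eq_intros simp: r_def D_def field_simps)
    then show ?thesis
      using assms(1) by (auto simp: has_field_derivative_iff G_def intro: filterlim_mono[OF _ order_refl at_le])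
  qed
  have "((\<lambda>\<epsilon>. (G (r + \<delta>) \<epsilon> / \<epsilon>) * (G (r - \<delta>) \<epsilon> / \<epsilon>)) \<longlongrightarrow>
      (D * (r - (r + \<delta>))) * (D * (r - (r - \<delta>)))) (at_right 0)"
    by (intro tendsto_mult lim)
  moreover have "(D * (r - (r + \<delta>))) * (D * (r - (r - \<delta>))) < 0"
  proof -
    have "(D * (r - (r + \<delta>))) * (D * (r - (r - \<delta>))) = - ((D * \<delta>)\<^sup>2)"
      by (simp add: power2_eq_square)
    also have "\<dots> < 0" using assms(2,3) by (simp add: D_def)
    finally show ?thesis .
  qed
  ultimately have "\<forall>\<^sub>F \<epsilon> in at_right 0. (G (r + \<delta>) \<epsilon> / \<epsilon>) * (G (r - \<delta>) \<epsilon> / \<epsilon>) < 0"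
    by (rule order_tendstoD(2))
  then show ?thesis
    using eventually_at_right_less[of "0::real"]
  proof eventually_elim
    case (elim \<epsilon>)
    then have "G (r + \<delta>) \<epsilon> * G (r - \<delta>) \<epsilon> < 0"
      by (auto simp: mult_less_0_iff zero_less_divide_iff divide_less_0_iff)
    moreover have "x - \<epsilon> * (r + \<delta>) < x - \<epsilon> * (r - \<delta>)"
      using elim assms(3) by simp
    ultimately obtain y where "x - \<epsilon> * (r + \<delta>) < y" "y < x - \<epsilon> * (r - \<delta>)"
      "poly (smult (1 - \<epsilon>) p + smult \<epsilon> q) y = 0"
      unfolding G_def using poly_IVT by blast
    then show ?case by (intro exI[of _ y]) (auto simp: algebra_simps abs_less_iff)
  qed
qed

text \<open>
  For small \<open>\<epsilon>\<close> the intervals around the first-order approximations are disjoint and in the order of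
  the \<open>a i\<close>. The \<open>n\<close> roots found in them are all roots of a polynomial of degree \<open>n\<close>, so the
  \<open>i\<close>-th largest root is the one in the \<open>i\<close>-th interval.
\<close>

lemma perturbed_ordered_roots_eventually:
  fixes p q :: "real poly"
  assumes lc: "lead_coeff p = 1" "lead_coeff q = 1" and deg: "degree p = n" "degree q = n"
    and root: "\<And>i. i < n \<Longrightarrow> poly p (a i) = 0"
    and simple: "\<And>i. i < n \<Longrightarrow> poly (pderiv p) (a i) \<noteq> 0"
    and dec: "\<And>i. Suc i < n \<Longrightarrow> a (Suc i) < a i"
    and "0 < \<delta>"
  defines "r \<equiv> \<lambda>i. poly q (a i) / poly (pderiv p) (a i)"
  shows "\<forall>\<^sub>F \<epsilon> in at_right 0. \<forall>i<n.
    \<bar>ordered_roots (smult (1 - \<epsilon>) p + smult \<epsilon> q) ! i - (a i - \<epsilon> * r i)\<bar> < \<epsilon> * \<delta>"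
proof -
  have "\<forall>\<^sub>F \<epsilon> in at_right 0. \<forall>i\<in>{..<n}. \<exists>y. \<bar>y - (a i - \<epsilon> * r i)\<bar> < \<epsilon> * \<delta> \<and>
      poly (smult (1 - \<epsilon>) p + smult \<epsilon> q) y = 0"
    unfolding r_def
    using perturbed_root_eventually[OF root simple \<open>0 < \<delta>\<close>]
    by (intro eventually_ball_finite) auto
  moreover have "\<forall>\<^sub>F \<epsilon> in at_right 0. \<forall>i\<in>{i. Suc i < n}.
      a (Suc i) - \<epsilon> * r (Suc i) + \<epsilon> * \<delta> < a i - \<epsilon> * r i - \<epsilon> * \<delta>"
  proof (intro eventually_ball_finite ballI)
    show "finite {i. Suc i < n}" by (rule finite_subset[of _ "{..<n}"]) auto
    fix i assume "i \<in> {i. Suc i < n}"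
    then have "a (Suc i) < a i" using dec by simp
    moreover have "((\<lambda>\<epsilon>. (a i - \<epsilon> * r i - \<epsilon> * \<delta>) - (a (Suc i) - \<epsilon> * r (Suc i) + \<epsilon> * \<delta>))
        \<longlongrightarrow> (a i - 0 * r i - 0 * \<delta>) - (a (Suc i) - 0 * r (Suc i) + 0 * \<delta>)) (at_right 0)"
      by (intro tendsto_intros)
    ultimately have "\<forall>\<^sub>F \<epsilon> in at_right 0.
        0 < (a i - \<epsilon> * r i - \<epsilon> * \<delta>) - (a (Suc i) - \<epsilon> * r (Suc i) + \<epsilon> * \<delta>)"
      by (intro order_tendstoD(1)) auto
    then show "\<forall>\<^sub>F \<epsilon> in at_right 0.
        a (Suc i) - \<epsilon> * r (Suc i) + \<epsilon> * \<delta> < a i - \<epsilon> * r i - \<epsilon> * \<delta>"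
      by eventually_elim simp
  qed
  ultimately show ?thesis
  proof eventually_elim
    case (elim \<epsilon>)
    let ?p = "smult (1 - \<epsilon>) p + smult \<epsilon> q"
    obtain y where y: "\<And>i. i < n \<Longrightarrow> \<bar>y i - (a i - \<epsilon> * r i)\<bar> < \<epsilon> * \<delta>"
      "\<And>i. i < n \<Longrightarrow> poly ?p (y i) = 0"
      using elim(1) by (metis lessThan_iff)
    have "coeff ?p n = 1" using lc deg by simp
    moreover have "degree ?p \<le> n"
      using deg by (intro degree_add_le order_trans[OF degree_smult_le]) auto
    ultimately have "degree ?p = n" "lead_coeff ?p = 1"
      using le_degree[of ?p n] by auto
    moreover have "y (Suc i) < y i" if "Suc i < n" for i
    proof -
      have "a (Suc i) - \<epsilon> * r (Suc i) + \<epsilon> * \<delta> < a i - \<epsilon> * r i - \<epsilon> * \<delta>"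
        using elim(2) that by simp
      then show ?thesis using y(1)[OF that] y(1)[OF Suc_lessD[OF that]] by linarith
    qed
    ultimately have "ordered_roots ?p = map y [0..<n]"
      using y(2) by (intro ordered_roots_eqI) auto
    then show ?case using y(1) by simp
  qed
qed

section \<open>Failure of strong majorization\<close>

text \<open>
  Moving from \<open>p\<close> towards \<open>q\<close> by \<open>\<epsilon>\<close> changes the sum of the \<open>m\<close> largest roots by \<open>- \<epsilon>\<close> times the
  partial sum, up to an error below \<open>m \<epsilon> \<delta>\<close>. A negative partial sum makes this an increase, whereas
  strong majorization says that this sum is largest at \<open>p\<close>.
\<close>

lemma not_strongly_majorizes_if_partial_sum_neg:
  fixes p q :: "real poly"
  assumes lc: "lead_coeff p = 1" "lead_coeff q = 1" and deg: "degree p = n" "degree q = n"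
    and rr: "real_rooted p" and sf: "rsquarefree p" and m: "m \<le> n"
    and neg: "(\<Sum>i<m. poly q (ordered_roots p ! i) / poly (pderiv p) (ordered_roots p ! i)) < 0"
  shows "\<not> p \<succeq>\<^sup>s q"
proof
  assume strong: "p \<succeq>\<^sup>s q"
  let ?a = "\<lambda>i. ordered_roots p ! i"
  define r where "r i = poly q (?a i) / poly (pderiv p) (?a i)" for i
  define s where "s = (\<Sum>i<m. r i)"
  have s: "s < 0" using neg by (simp add: s_def r_def)
  \<comment> \<open>The total error of the \<open>m\<close> roots must stay strictly below the first-order gain \<open>- s\<close>.\<close>
  define \<delta> where "\<delta> = - s / (real m + 1)"
  have \<delta>: "0 < \<delta>" "real m * \<delta> < - s" using s by (auto simp: \<delta>_def field_simps)
  have simple: "poly (pderiv p) (?a i) \<noteq> 0" if "i < n" for i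
    using sf ordered_roots_simple(1)[OF rr sf deg(1) that] by (auto simp: rsquarefree_roots)
  have "\<forall>\<^sub>F \<epsilon> in at_right 0. \<forall>i<n.
      \<bar>ordered_roots (smult (1 - \<epsilon>) p + smult \<epsilon> q) ! i - (?a i - \<epsilon> * r i)\<bar> < \<epsilon> * \<delta>"
    unfolding r_def
    by (rule perturbed_ordered_roots_eventually)
       (use lc deg simple \<delta> ordered_roots_simple[OF rr sf deg(1)] in auto)
  moreover have "\<forall>\<^sub>F \<epsilon> in at_right (0::real). \<epsilon> \<in> {0<..<1}"
    by (rule eventually_at_right_real) simp
  ultimately have "\<forall>\<^sub>F \<epsilon> in at_right (0::real). \<epsilon> \<in> {0<..<1} \<and> (\<forall>i<n.
      \<bar>ordered_roots (smult (1 - \<epsilon>) p + smult \<epsilon> q) ! i - (?a i - \<epsilon> * r i)\<bar> < \<epsilon> * \<delta>)"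
    by eventually_elim auto
  then obtain \<epsilon> where \<epsilon>: "0 < \<epsilon>" "\<epsilon> < 1" and close: "\<And>i. i < n \<Longrightarrow>
      \<bar>ordered_roots (smult (1 - \<epsilon>) p + smult \<epsilon> q) ! i - (?a i - \<epsilon> * r i)\<bar> < \<epsilon> * \<delta>"
    by (auto dest!: eventually_happens'[OF trivial_limit_at_right_real])
  let ?b = "\<lambda>i. ordered_roots (smult (1 - \<epsilon>) p + smult \<epsilon> q) ! i"
  have "smult 1 p + smult (1 - 1) q \<succeq> smult (1 - \<epsilon>) p + smult (1 - (1 - \<epsilon>)) q"
    by (rule strong[unfolded strongly_majorizes_def, rule_format, of "1 - \<epsilon>" 1]) (use \<epsilon> in auto)
  then have "(\<Sum>i<m. ?b i) \<le> (\<Sum>i<m. ?a i)"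
    using m length_ordered_roots[OF rr] deg by (simp add: majorizes_def vec_majorizes_def)
  moreover have "(\<Sum>i<m. ?a i - \<epsilon> * r i - \<epsilon> * \<delta>) \<le> (\<Sum>i<m. ?b i)"
  proof (rule sum_mono)
    fix i assume "i \<in> {..<m}"
    then have "i < n" using m by simp
    from close[OF this] show "?a i - \<epsilon> * r i - \<epsilon> * \<delta> \<le> ?b i" by linarith
  qed
  moreover have "(\<Sum>i<m. ?a i - \<epsilon> * r i - \<epsilon> * \<delta>) = (\<Sum>i<m. ?a i) + \<epsilon> * (- s - real m * \<delta>)"
    unfolding sum_subtractf sum_distrib_left[symmetric] s_def by (simp add: algebra_simps)
  moreover have "\<epsilon> * (- s - real m * \<delta>) > 0" using \<epsilon> \<delta> by simp
  ultimately show False by linarith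
qed

theorem theorem4p1:
  fixes p q :: "real poly" and n k :: nat
  assumes "lead_coeff p = 1" and "lead_coeff q = 1"
    and "degree p = n" and "degree q = n"
    and "real_rooted p" and "real_rooted q"
    and "rsquarefree p" and "rsquarefree q"
    and "common_interlacer p q"
    and "\<forall>x. \<not> (poly p x = 0 \<and> poly q x = 0)"
    and "p \<succeq> q"
    and "1 < k" and "k < n"
    and "(\<Sum>i<k. ordered_roots p ! i) = (\<Sum>i<k. ordered_roots q ! i)"
  shows "(\<exists>k0. 1 \<le> k0 \<and> k0 \<le> k \<and>
            (\<Sum>i<k0. poly q (ordered_roots p ! i) / poly (pderiv p) (ordered_roots p ! i)) < 0)
         \<and> \<not> p \<succeq>\<^sup>s q"
proof -
  define a where "a i = ordered_roots p ! i" for i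
  define b where "b i = ordered_roots q ! i" for i
  have a: "\<And>i. i < n \<Longrightarrow> poly p (a i) = 0" "\<And>i. Suc i < n \<Longrightarrow> a (Suc i) < a i"
    using ordered_roots_simple[OF assms(5,7,3)] by (auto simp: a_def)
  have b: "\<And>i. i < n \<Longrightarrow> poly q (b i) = 0" "\<And>i. Suc i < n \<Longrightarrow> b (Suc i) < b i"
    using ordered_roots_simple[OF assms(6,8,4)] by (auto simp: b_def)
  have p: "p = (\<Prod>i<n. [:- a i, 1:])" and q: "q = (\<Prod>i<n. [:- b i, 1:])"
    using assms a b by (auto intro!: monic_eq_prod_roots inj_on_if_Suc_less)
  have len: "length (ordered_roots p) = n" "length (ordered_roots q) = n"
    using assms length_ordered_roots by auto
  have "\<exists>m. 1 \<le> m \<and> m \<le> k \<and>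
    (\<Sum>i<m. (\<Prod>j<n. a i - b j) / (\<Prod>j\<in>{..<n}-{i}. a i - a j)) < 0"
  proof (rule lagrange_partial_sum_neg)
    show "b (Suc i) \<le> a i" if "Suc i < n" for i
      using common_interlacer_iff[OF assms(5,6,3,4)] assms(9,13) that by (auto simp: a_def b_def)
    show "a i \<noteq> b j" if "i < n" "j < n" for i j
      using a(1)[OF that(1)] b(1)[OF that(2)] assms(10) by auto
  qed (use a b assms(11-14) len in \<open>auto simp: majorizes_def vec_majorizes_def a_def b_def\<close>)
  then obtain m where m: "1 \<le> m" "m \<le> k"
    "(\<Sum>i<m. (\<Prod>j<n. a i - b j) / (\<Prod>j\<in>{..<n}-{i}. a i - a j)) < 0" by blast
  have "poly q (a i) / poly (pderiv p) (a i)
      = (\<Prod>j<n. a i - b j) / (\<Prod>j\<in>{..<n}-{i}. a i - a j)" if "i < n" for i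
    using that by (simp add: p q poly_prod_linear poly_pderiv_prod_linear)
  then have neg: "(\<Sum>i<m. poly q (a i) / poly (pderiv p) (a i)) < 0"
    using m assms(13) by simp
  then have "\<not> p \<succeq>\<^sup>s q"
    using not_strongly_majorizes_if_partial_sum_neg[OF assms(1-5,7), of m] m assms(13)
    by (simp add: a_def)
  with neg m show ?thesis by (auto simp: a_def)
qed

end
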